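(* Let $\lambda_0,\lambda_1\in\mathbb{C}\setminus\{0\}$ with $|\lambda_0|^2+|\lambda_1|^2=1$, let $P_0,P_1$ be the two one-dimensional projectors onto the coordinate axes of $\mathbb{C}^2$, and let $O_i=\lambda_iP_i$ ($i=0,1$). Then the bounded lattice $Lq(\mathbb{C}^2)=(S,\overset{\circ}{\wedge},\vee,\hat I,0)$ with underlying set $S=\{0,O_0,O_1,\hat I\}$, $\hat I=O_0+O_1$, and with the map $X^\perp=\hat I-X$ as orthocomplementation, is an orthomodular lattice which is moreover modular and distributive.
   Context: $P_0=\begin{pmatrix}1&0\\0&0\end{pmatrix}$, $P_1=\begin{pmatrix}0&0\\0&1\end{pmatrix}$. The meet of $O_i,O_j$ is defined by $$O_i\overset{\circ}{\wedge}O_j=\frac{1}{\sqrt{\lambda_i}\sqrt{\lambda_j}}\,O_iO_j\qquad(i,j\in\{0,1\}),$$ where $\sqrt{\lambda_i}$ is a fixed square root of $\lambda_i$. Thus $O_i\overset{\circ}{\wedge}O_i=O_i$, and $O_0\overset{\circ}{\wedge}O_1=0$. The meet is extended to $\hat I=O_0+O_1$ by additivity in each argument, and satisfies $X\overset{\circ}{\wedge}0=0\overset{\circ}{\wedge}X=0$. The join is $X\vee Y=X+Y-X\overset{\circ}{\wedge}Y$. The order is $X\le Y$ iff $X\overset{\circ}{\wedge}Y=X$ (iff $X\vee Y=Y$). An orthocomplementation on a bounded lattice is an order-reversing involution $a\mapsto a^\perp$ with $a\vee a^\perp=1$ and $a\wedge a^\perp=0$. A lattice with an orthocomplementation is orthomodular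 if $a\le c$ implies $a\vee(a^\perp\wedge c)=c$. *)

theory Defs
  imports "HOL-Analysis.Analysis" "HOL-Algebra.Lattice"
begin

section \<open>Lattices given by a carrier set and two operations\<close>

definition meet_order :: "'a set \<Rightarrow> ('a \<Rightarrow> 'a \<Rightarrow> 'a) \<Rightarrow> 'a gorder" where
  "meet_order S m = \<lparr>carrier = S, eq = (=), le = (\<lambda>x y. m x y = x)\<rparr>"

text \<open>\<open>(S, m, j, t, b)\<close> is a bounded lattice: the order \<open>m x y = x\<close> makes \<open>S\<close> a bounded
  lattice, whose infimum, supremum, greatest and least element are the given \<open>m\<close>, \<open>j\<close>, \<open>t\<close>, \<open>b\<close>.
  Closure of \<open>S\<close> under the operations follows.\<close>

locale bounded_lattice_on =
  fixes S :: "'a set" and m j :: "'a \<Rightarrow> 'a \<Rightarrow> 'a" and t b :: 'a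
  assumes bounded_lattice_order: "bounded_lattice (meet_order S m)"
    and inf_eq: "\<lbrakk>x \<in> S; y \<in> S\<rbrakk> \<Longrightarrow> m x y = x \<sqinter>\<^bsub>meet_order S m\<^esub> y"
    and sup_eq: "\<lbrakk>x \<in> S; y \<in> S\<rbrakk> \<Longrightarrow> j x y = x \<squnion>\<^bsub>meet_order S m\<^esub> y"
    and top_eq: "t = \<top>\<^bsub>meet_order S m\<^esub>"
    and bot_eq: "b = \<bottom>\<^bsub>meet_order S m\<^esub>"

locale ortholattice_on = bounded_lattice_on +
  fixes c :: "'a \<Rightarrow> 'a"
  assumes compl_closed: "x \<in> S \<Longrightarrow> c x \<in> S"
    and compl_involution: "x \<in> S \<Longrightarrow> c (c x) = x"
    and compl_antimono: "\<lbrakk>x \<in> S; y \<in> S; x \<sqsubseteq>\<^bsub>meet_order S m\<^esub> y\<rbrakk> \<Longrightarrow> c y \<sqsubseteq>\<^bsub>meet_order S m\<^esub> c x"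
    and join_compl: "x \<in> S \<Longrightarrow> j x (c x) = t"
    and meet_compl: "x \<in> S \<Longrightarrow> m x (c x) = b"

locale orthomodular_lattice_on = ortholattice_on +
  assumes orthomodular: "\<lbrakk>x \<in> S; z \<in> S; x \<sqsubseteq>\<^bsub>meet_order S m\<^esub> z\<rbrakk> \<Longrightarrow> j x (m (c x) z) = z"

locale modular_lattice_on = bounded_lattice_on +
  assumes modular: "\<lbrakk>x \<in> S; y \<in> S; z \<in> S; x \<sqsubseteq>\<^bsub>meet_order S m\<^esub> z\<rbrakk>
    \<Longrightarrow> j x (m y z) = m (j x y) z"

locale distributive_lattice_on = bounded_lattice_on +
  assumes meet_join_distrib: "\<lbrakk>x \<in> S; y \<in> S; z \<in> S\<rbrakk> \<Longrightarrow> m x (j y z) = j (m x y) (m x z)"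
    and join_meet_distrib: "\<lbrakk>x \<in> S; y \<in> S; z \<in> S\<rbrakk> \<Longrightarrow> j x (m y z) = m (j x y) (j x z)"

section \<open>The operators and their lattice operations\<close>

type_synonym cmat2 = "complex^2^2"

definition cscale :: "complex \<Rightarrow> cmat2 \<Rightarrow> cmat2"  (infixr \<open>*\<^sub>M\<close> 75) where
  "k *\<^sub>M A = map_matrix ((*) k) A"

text \<open>Only the indices \<open>0\<close> and \<open>1\<close> are meaningful below.\<close>

definition Pr :: "nat \<Rightarrow> cmat2" where
  "Pr i = (if i = 0 then vector [vector [1, 0], vector [0, 0]]
                    else vector [vector [0, 0], vector [0, 1]])"

definition Op :: "(nat \<Rightarrow> complex) \<Rightarrow> nat \<Rightarrow> cmat2" where
  "Op lam i = lam i *\<^sub>M Pr i"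

definition Ihat :: "(nat \<Rightarrow> complex) \<Rightarrow> cmat2" where
  "Ihat lam = Op lam 0 + Op lam 1"

definition Lq_set :: "(nat \<Rightarrow> complex) \<Rightarrow> cmat2 set" where
  "Lq_set lam = {0, Op lam 0, Op lam 1, Ihat lam}"

text \<open>The meet of two of the \<open>Op lam i\<close>; \<open>r i\<close> is the fixed square root of \<open>lam i\<close>.\<close>

definition basic_meet :: "(nat \<Rightarrow> complex) \<Rightarrow> (nat \<Rightarrow> complex) \<Rightarrow> nat \<Rightarrow> nat \<Rightarrow> cmat2" where
  "basic_meet lam r i j = (1 / (r i * r j)) *\<^sub>M (Op lam i ** Op lam j)"

text \<open>Every \<open>X\<close> in \<open>Lq_set lam\<close> is the sum of the \<open>Op lam i\<close> over a unique set of indices (for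
  nonzero \<open>lam\<close>), so extending the meet additively means summing over these indices. The lemmas below
  confirm that this yields the defining equations of the meet, which determine it on
  \<open>Lq_set lam\<close>.\<close>

definition summands :: "(nat \<Rightarrow> complex) \<Rightarrow> cmat2 \<Rightarrow> nat set" where
  "summands lam X = (THE A. A \<subseteq> {0, 1} \<and> X = (\<Sum>i\<in>A. Op lam i))"

definition q_meet :: "(nat \<Rightarrow> complex) \<Rightarrow> (nat \<Rightarrow> complex) \<Rightarrow> cmat2 \<Rightarrow> cmat2 \<Rightarrow> cmat2" where
  "q_meet lam r X Y = (\<Sum>i\<in>summands lam X. \<Sum>j\<in>summands lam Y. basic_meet lam r i j)"

definition q_join :: "(nat \<Rightarrow> complex) \<Rightarrow> (nat \<Rightarrow> complex) \<Rightarrow> cmat2 \<Rightarrow> cmat2 \<Rightarrow> cmat2" where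
  "q_join lam r X Y = X + Y - q_meet lam r X Y"

definition q_compl :: "(nat \<Rightarrow> complex) \<Rightarrow> cmat2 \<Rightarrow> cmat2" where
  "q_compl lam X = Ihat lam - X"

lemma Op_entries:
  "Op lam 0 $ 1 $ 1 = lam 0" "Op lam 0 $ 2 $ 2 = 0" "Op lam 0 $ 1 $ 2 = 0" "Op lam 0 $ 2 $ 1 = 0"
  "Op lam (Suc 0) $ 1 $ 1 = 0" "Op lam (Suc 0) $ 2 $ 2 = lam 1"
  "Op lam (Suc 0) $ 1 $ 2 = 0" "Op lam (Suc 0) $ 2 $ 1 = 0"
  by (simp_all add: Op_def cscale_def Pr_def)

lemma summands_sum:
  assumes "lam 0 \<noteq> 0" "lam 1 \<noteq> 0" and A: "A \<subseteq> {0, 1}"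
  shows "summands lam (\<Sum>i\<in>A. Op lam i) = A"
  unfolding summands_def
proof (rule the_equality)
  fix B assume B: "B \<subseteq> {0, 1} \<and> sum (Op lam) A = sum (Op lam) B"
  have *: "(0 \<in> C \<longleftrightarrow> sum (Op lam) C $ 1 $ 1 \<noteq> 0) \<and> (1 \<in> C \<longleftrightarrow> sum (Op lam) C $ 2 $ 2 \<noteq> 0)"
    if "C \<subseteq> {0, 1}" for C
  proof -
    have "C = {} \<or> C = {0} \<or> C = {1} \<or> C = {0, 1}" using that by blast
    then show ?thesis using assms(1,2) by (auto simp: Op_entries)
  qed
  show "B = A" using *[of A] *[of B] A B by auto
qed (use A in simp)

lemma summands_simps:
  assumes "lam 0 \<noteq> 0" "lam 1 \<noteq> 0"
  shows "summands lam 0 = {}" "summands lam (Op lam 0) = {0}" "summands lam (Op lam 1) = {1}"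
    "summands lam (Ihat lam) = {0, 1}"
  using summands_sum[OF assms, of "{}"] summands_sum[OF assms, of "{0}"]
    summands_sum[OF assms, of "{1}"] summands_sum[OF assms, of "{0, 1}"]
  by (simp_all add: Ihat_def)

lemma q_meet_Op:
  assumes "lam 0 \<noteq> 0" "lam 1 \<noteq> 0" "i \<in> {0, 1}" "j \<in> {0, 1}"
  shows "q_meet lam r (Op lam i) (Op lam j) = (1 / (r i * r j)) *\<^sub>M (Op lam i ** Op lam j)"
proof -
  have "summands lam (Op lam k) = {k}" if "k \<in> {0, 1}" for k
    using that summands_simps(2,3)[OF assms(1,2)] by auto
  then show ?thesis using assms(3,4) by (simp add: q_meet_def basic_meet_def)
qed

lemma q_meet_additive:
  assumes "lam 0 \<noteq> 0" "lam 1 \<noteq> 0"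
  shows "q_meet lam r (Ihat lam) Y = q_meet lam r (Op lam 0) Y + q_meet lam r (Op lam 1) Y"
    "q_meet lam r Y (Ihat lam) = q_meet lam r Y (Op lam 0) + q_meet lam r Y (Op lam 1)"
  by (simp_all only: q_meet_def summands_simps[OF assms]) (simp_all add: sum.distrib)

lemma q_meet_zero:
  assumes "lam 0 \<noteq> 0" "lam 1 \<noteq> 0"
  shows "q_meet lam r 0 Y = 0" "q_meet lam r Y 0 = 0"
  by (simp_all add: q_meet_def summands_simps[OF assms])

end

(* The map sending a set A of indices to the sum of the Op lam i with i in A is a bijection
   from the subsets of {0, 1} onto Lq_set lam. It carries intersection, union and complement to
   q_meet, q_join and q_compl: the square roots in the meet are chosen so that
   Op lam 0 and Op lam 1 become orthogonal idempotents. So the structure is a copy of the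
   Boolean algebra of subsets of {0, 1}. *)
theory Submission
  imports Defs
begin

text \<open>The shape of the meet once \<open>basic_meet\<close> is known to vanish off the
  diagonal: only pairs of equal indices contribute, and these are indexed by the
  intersection.\<close>

lemma sum_delta_inter:
  assumes "finite A" "finite B"
  shows "(\<Sum>i\<in>A. \<Sum>j\<in>B. if i = j then f i else 0) = sum f (A \<inter> B)"
  using assms by (simp add: sum.inter_restrict)

text \<open>Separates the order theory from the matrices: inside the locale each lattice law becomes
  an identity between subsets of \<open>U\<close>.\<close>

locale powerset_copy =
  fixes h :: "'i set \<Rightarrow> 'a" and U :: "'i set" and S :: "'a set"
    and m j :: "'a \<Rightarrow> 'a \<Rightarrow> 'a" and c :: "'a \<Rightarrow> 'a"
  assumes bij: "bij_betw h (Pow U) S"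
    and meet: "\<lbrakk>A \<subseteq> U; B \<subseteq> U\<rbrakk> \<Longrightarrow> m (h A) (h B) = h (A \<inter> B)"
    and join: "\<lbrakk>A \<subseteq> U; B \<subseteq> U\<rbrakk> \<Longrightarrow> j (h A) (h B) = h (A \<union> B)"
    and compl: "A \<subseteq> U \<Longrightarrow> c (h A) = h (U - A)"
begin

lemma mem_cases [consumes 1]:
  assumes "x \<in> S"
  obtains A where "A \<subseteq> U" "x = h A"
  using assms bij by (auto simp: bij_betw_def)

lemma mem [simp]: "A \<subseteq> U \<Longrightarrow> h A \<in> S"
  using bij by (auto simp: bij_betw_def)

lemma eq_iff [simp]: "\<lbrakk>A \<subseteq> U; B \<subseteq> U\<rbrakk> \<Longrightarrow> h A = h B \<longleftrightarrow> A = B"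
  using bij by (auto simp: bij_betw_def inj_on_def)

text \<open>The order unfolds to \<open>h (A \<inter> B) = h A\<close>, and injectivity of
  \<open>h\<close> turns this into \<open>A \<inter> B = A\<close>.\<close>

lemma le_iff [simp]: "\<lbrakk>A \<subseteq> U; B \<subseteq> U\<rbrakk> \<Longrightarrow> h A \<sqsubseteq>\<^bsub>meet_order S m\<^esub> h B \<longleftrightarrow> A \<subseteq> B"
  by (subst inf.absorb_iff1) (simp add: meet_order_def meet le_infI1)

lemma carrier_order [simp]: "carrier (meet_order S m) = S"
  by (simp add: meet_order_def)

lemma eq_order [simp]: "(.=\<^bsub>meet_order S m\<^esub>) = (=)"
  by (simp add: meet_order_def)

lemma partial_order: "partial_order (meet_order S m)"
  by unfold_locales (auto elim!: mem_cases)

lemma greatest_Lower: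
  assumes "A \<subseteq> U" "B \<subseteq> U"
  shows "greatest (meet_order S m) (h (A \<inter> B)) (Lower (meet_order S m) {h A, h B})"
  using assms by (auto simp: greatest_def Lower_def le_infI1 elim!: mem_cases)

lemma least_Upper:
  assumes "A \<subseteq> U" "B \<subseteq> U"
  shows "least (meet_order S m) (h (A \<union> B)) (Upper (meet_order S m) {h A, h B})"
  using assms by (auto simp: least_def Upper_def elim!: mem_cases)

lemma greatest_top: "greatest (meet_order S m) (h U) S"
  by (auto simp: greatest_def elim!: mem_cases)

lemma least_bottom: "least (meet_order S m) (h {}) S"
  by (auto simp: least_def elim!: mem_cases)

lemma bounded_lattice_order: "bounded_lattice (meet_order S m)"
proof -
  interpret partial_order "meet_order S m"
    by (rule partial_order)
  show ?thesis
  proof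
    fix x y assume "x \<in> carrier (meet_order S m)" "y \<in> carrier (meet_order S m)"
    then obtain A B where "A \<subseteq> U" "B \<subseteq> U" "x = h A" "y = h B"
      by (auto elim!: mem_cases)
    then show "\<exists>s. least (meet_order S m) s (Upper (meet_order S m) {x, y})"
      and "\<exists>s. greatest (meet_order S m) s (Lower (meet_order S m) {x, y})"
      using least_Upper greatest_Lower by blast+
  qed (use greatest_top least_bottom in auto)
qed

lemma bounded_lattice_on: "bounded_lattice_on S m j (h U) (h {})"
proof -
  interpret L: bounded_lattice "meet_order S m"
    by (rule bounded_lattice_order)
  show ?thesis
  proof
    fix x y assume "x \<in> S" "y \<in> S"
    then obtain A B where AB: "A \<subseteq> U" "B \<subseteq> U" "x = h A" "y = h B"
      by (auto elim!: mem_cases)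
    show "m x y = x \<sqinter>\<^bsub>meet_order S m\<^esub> y"
      \<comment> \<open>The infimum of the order is a chosen greatest lower bound; by uniqueness it
        is the one exhibited in \<open>greatest_Lower\<close>.\<close>
      by (rule L.meetI) (use AB in \<open>simp_all add: meet L.greatest_unique[OF greatest_Lower]\<close>)
    show "j x y = x \<squnion>\<^bsub>meet_order S m\<^esub> y"
      by (rule L.joinI) (use AB in \<open>simp_all add: join L.least_unique[OF least_Upper]\<close>)
  next
    show "h U = \<top>\<^bsub>meet_order S m\<^esub>" "h {} = \<bottom>\<^bsub>meet_order S m\<^esub>"
      by (rule L.top_eq L.bottom_eq; auto elim!: mem_cases)+
  qed
qed

lemma orthomodular_lattice_on: "orthomodular_lattice_on S m j (h U) (h {}) c"
proof -
  interpret bounded_lattice_on S m j "h U" "h {}"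
    by (rule bounded_lattice_on)
  show ?thesis
  proof
    fix x z assume "x \<in> S" "z \<in> S" and le: "x \<sqsubseteq>\<^bsub>meet_order S m\<^esub> z"
    then obtain A B where AB: "A \<subseteq> U" "B \<subseteq> U" "x = h A" "z = h B"
      by (auto elim!: mem_cases)
    with le have "A \<subseteq> B" by simp
    \<comment> \<open>A point of \<open>B\<close> outside \<open>A\<close> lies in
      \<open>U - A\<close> because \<open>B \<subseteq> U\<close>.\<close>
    moreover from this AB have "A \<union> (U - A) \<inter> B = B" by auto
    ultimately show "j x (m (c x) z) = z" and "c z \<sqsubseteq>\<^bsub>meet_order S m\<^esub> c x"
      using AB by (auto simp: compl meet join le_infI1)
  next
    fix x assume "x \<in> S"
    then obtain A where A: "A \<subseteq> U" "x = h A"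
      by (auto elim!: mem_cases)
    then show "c x \<in> S" "c (c x) = x" "j x (c x) = h U" "m x (c x) = h {}"
      by (simp_all add: compl meet join double_diff Un_absorb1)
  qed
qed

lemma modular_lattice_on: "modular_lattice_on S m j (h U) (h {})"
proof -
  interpret bounded_lattice_on S m j "h U" "h {}"
    by (rule bounded_lattice_on)
  show ?thesis
  proof
    fix x y z assume "x \<in> S" "y \<in> S" "z \<in> S" and le: "x \<sqsubseteq>\<^bsub>meet_order S m\<^esub> z"
    then obtain A B C where ABC: "A \<subseteq> U" "B \<subseteq> U" "C \<subseteq> U" "x = h A" "y = h B" "z = h C"
      by (auto elim!: mem_cases)
    \<comment> \<open>Distributing the union gives
      \<open>(A \<union> B) \<inter> (A \<union> C)\<close>, and \<open>A \<union> C = C\<close>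
      since \<open>le\<close> means \<open>A \<subseteq> C\<close>.\<close>
    with le have "A \<union> B \<inter> C = (A \<union> B) \<inter> C" by auto
    with ABC show "j x (m y z) = m (j x y) z"
      by (simp add: meet join le_infI1)
  qed
qed

lemma distributive_lattice_on: "distributive_lattice_on S m j (h U) (h {})"
proof -
  interpret bounded_lattice_on S m j "h U" "h {}"
    by (rule bounded_lattice_on)
  show ?thesis
  proof
    fix x y z assume "x \<in> S" "y \<in> S" "z \<in> S"
    then obtain A B C where "A \<subseteq> U" "B \<subseteq> U" "C \<subseteq> U" "x = h A" "y = h B" "z = h C"
      by (auto elim!: mem_cases)
    then show "m x (j y z) = j (m x y) (m x z)" "j x (m y z) = m (j x y) (j x z)"
      \<comment> \<open>Fixing the first operand to \<open>A\<close> keeps the two distributive laws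
        from rewriting each other's results.\<close>
      by (simp_all only: meet join le_infI1 Un_least Int_Un_distrib[of A] Un_Int_distrib[of A])
  qed
qed

end

text \<open>For equal indices the matrix product is \<open>lam i\<close> times
  \<open>Op lam i\<close>, and the factor \<open>1 / (r i * r i)\<close> cancels
  \<open>lam i\<close>, whichever square root is chosen. For distinct indices the projectors
  multiply to zero.\<close>

lemma basic_meet_eq:
  assumes "lam 0 \<noteq> 0" "lam 1 \<noteq> 0" "(r 0)\<^sup>2 = lam 0" "(r 1)\<^sup>2 = lam 1"
    and "i \<in> {0, 1}" "k \<in> {0, 1}"
  shows "basic_meet lam r i k = (if i = k then Op lam i else 0)"
proof -
  have "r 0 * r 0 = lam 0" "r (Suc 0) * r (Suc 0) = lam (Suc 0)"
    using assms(3,4) by (simp_all add: power2_eq_square)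
  with assms(1,2,5,6) show ?thesis
    by (auto simp: vec_eq_iff forall_2 sum_2 basic_meet_def cscale_def Op_def Pr_def
        matrix_matrix_mult_def)
qed

lemma q_meet_sum:
  assumes "lam 0 \<noteq> 0" "lam 1 \<noteq> 0" "(r 0)\<^sup>2 = lam 0" "(r 1)\<^sup>2 = lam 1"
    and A: "A \<subseteq> {0, 1}" and B: "B \<subseteq> {0, 1}"
  shows "q_meet lam r (sum (Op lam) A) (sum (Op lam) B) = sum (Op lam) (A \<inter> B)"
proof -
  have "q_meet lam r (sum (Op lam) A) (sum (Op lam) B) = (\<Sum>i\<in>A. \<Sum>k\<in>B. basic_meet lam r i k)"
    by (simp add: q_meet_def summands_sum[OF assms(1,2) A] summands_sum[OF assms(1,2) B])
  also have "\<dots> = (\<Sum>i\<in>A. \<Sum>k\<in>B. if i = k then Op lam i else 0)"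
    using A B by (intro sum.cong refl basic_meet_eq assms(1-4)) auto
  also have "\<dots> = sum (Op lam) (A \<inter> B)"
    using A B by (intro sum_delta_inter) (auto intro: finite_subset)
  finally show ?thesis .
qed

lemma Ihat_eq_sum: "Ihat lam = sum (Op lam) {0, 1}"
  by (simp add: Ihat_def)

lemma Lq_set_eq_image: "Lq_set lam = sum (Op lam) ` Pow {0, 1}"
  by (auto simp: Lq_set_def Ihat_def Pow_insert)

lemma powerset_copy_Lq:
  assumes "lam 0 \<noteq> 0" "lam 1 \<noteq> 0" "(r 0)\<^sup>2 = lam 0" "(r 1)\<^sup>2 = lam 1"
  shows "powerset_copy (sum (Op lam)) {0, 1} (Lq_set lam) (q_meet lam r) (q_join lam r) (q_compl lam)"
proof
  show "bij_betw (sum (Op lam)) (Pow {0, 1}) (Lq_set lam)"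
    unfolding bij_betw_def Lq_set_eq_image
    \<comment> \<open>Injectivity holds because \<open>summands lam\<close> recovers the index set
      from the sum.\<close>
    by (intro conjI inj_on_inverseI[where g = "summands lam"] refl)
      (rule summands_sum[OF assms(1,2)], blast)
next
  fix A B :: "nat set" assume A: "A \<subseteq> {0, 1}" and B: "B \<subseteq> {0, 1}"
  then have fin: "finite A" "finite B" by (auto intro: finite_subset)
  show meet: "q_meet lam r (sum (Op lam) A) (sum (Op lam) B) = sum (Op lam) (A \<inter> B)"
    by (rule q_meet_sum) (use assms A B in auto)
  show "q_join lam r (sum (Op lam) A) (sum (Op lam) B) = sum (Op lam) (A \<union> B)"
    \<comment> \<open>With the meet known to be the sum over \<open>A \<inter> B\<close>, the
      formula for the join is inclusion-exclusion.\<close>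
    unfolding q_join_def meet by (rule sum_Un[OF fin, symmetric])
next
  fix A :: "nat set" assume "A \<subseteq> {0, 1}"
  then show "q_compl lam (sum (Op lam) A) = sum (Op lam) ({0, 1} - A)"
    unfolding q_compl_def Ihat_eq_sum by (subst sum_diff) auto
qed

theorem mainTheorem4:
  fixes lam r :: "nat \<Rightarrow> complex"
  assumes "lam 0 \<noteq> 0" and "lam 1 \<noteq> 0"
    and "(cmod (lam 0))\<^sup>2 + (cmod (lam 1))\<^sup>2 = 1"
    and "(r 0)\<^sup>2 = lam 0" and "(r 1)\<^sup>2 = lam 1"
  shows "orthomodular_lattice_on (Lq_set lam) (q_meet lam r) (q_join lam r) (Ihat lam) 0 (q_compl lam)
    \<and> modular_lattice_on (Lq_set lam) (q_meet lam r) (q_join lam r) (Ihat lam) 0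
    \<and> distributive_lattice_on (Lq_set lam) (q_meet lam r) (q_join lam r) (Ihat lam) 0"
proof -
  interpret powerset_copy "sum (Op lam)" "{0, 1}" "Lq_set lam" "q_meet lam r" "q_join lam r"
      "q_compl lam"
    by (rule powerset_copy_Lq) fact+
  show ?thesis
    using orthomodular_lattice_on modular_lattice_on distributive_lattice_on
    \<comment> \<open>Matches the bounds: the top is the sum over \<open>{0, 1}\<close>, the bottom
      the empty sum.\<close>
    unfolding Ihat_eq_sum sum.empty by blast
qed

end
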